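(* For every real number $x \ge 0$, $$Q(x) \ge \frac{1}{2}\, e^{-\frac{1}{2}x^2 - \sqrt{\frac{2}{\pi}}\,x}$$ and $$Q(x) \le \frac{1}{2}\, e^{-\frac{1}{\pi}x^2 - \sqrt{\frac{2}{\pi}}\,x},$$ where $Q$ denotes the Gaussian Q-function.
   Context: The Gaussian Q-function is the tail probability of a standard normal random variable: for $x \in \mathbb{R}$, $$Q(x) = \frac{1}{\sqrt{2\pi}} \int_x^\infty e^{-\frac{u^2}{2}} \, du.$$ *)

theory Defs
  imports "HOL-Probability.Probability"
begin

definition gaussian_Q :: "real \<Rightarrow> real" where
  "gaussian_Q x = 1 / sqrt (2 * pi) * (LBINT u:{x..}. exp (- (u\<^sup>2 / 2)))"

text \<open>The integrand is integrable, so the integral is not the default value 0, and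
  the definition is the tail probability of a standard normal random variable.\<close>

lemma gaussian_Q_integrable:
  "set_integrable lborel {x..} (\<lambda>u::real. exp (- (u\<^sup>2 / 2)))"
proof -
  have "integrable lborel (\<lambda>u. sqrt (2 * pi) * std_normal_density u)"
    by (intro integrable_mult_right integrable_normal_density) simp
  then have "integrable lborel (\<lambda>u::real. exp (- (u\<^sup>2 / 2)))"
    by (simp add: std_normal_density_def)
  then have "set_integrable lborel UNIV (\<lambda>u::real. exp (- (u\<^sup>2 / 2)))"
    by (simp add: set_integrable_def)
  then show ?thesis
    by (rule set_integrable_subset) auto
qed

lemma (in prob_space) gaussian_Q_eq_tail_prob:
  assumes "distributed M lborel X std_normal_density"
  shows "gaussian_Q x = \<P>(\<omega> in M. X \<omega> > x)"
proof -
  have [measurable]: "X \<in> borel_measurable M"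
    using distributed_measurable[OF assms] by simp
  have "\<P>(\<omega> in M. X \<omega> > x) = (\<integral>\<omega>. indicator {\<omega> \<in> space M. X \<omega> > x} \<omega> \<partial>M)"
    by simp
  also have "\<dots> = (\<integral>\<omega>. indicator {x<..} (X \<omega>) \<partial>M)"
    by (rule Bochner_Integration.integral_cong) (auto simp: indicator_def)
  also have "\<dots> = (LBINT u. std_normal_density u * indicator {x<..} u)"
    by (rule distributed_integral[OF assms, symmetric]) auto
  also have "\<dots> = (LBINT u. indicator {x..} u * std_normal_density u)"
  proof (rule integral_cong_AE)
    show "AE u in lborel. std_normal_density u * indicator {x<..} u
        = indicator {x..} u * std_normal_density u"
      using AE_lborel_singleton[of x] by eventually_elim (auto simp: indicator_def)
  qed auto
  also have "\<dots> = gaussian_Q x"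
    by (simp add: gaussian_Q_def set_lebesgue_integral_def std_normal_density_def)
  finally show ?thesis ..
qed

end

theory Submission
  imports Defs "HOL-Real_Asymp.Real_Asymp"
begin

text \<open>
  Both bounds agree with \<^term>\<open>gaussian_Q\<close> at \<open>0\<close>, where all three functions equal \<open>1/2\<close>, and at
  infinity, where all three vanish. So the difference \<open>f\<close> of the two sides vanishes at both ends of
  the half-line, and it is nonnegative as soon as it first rises and then falls.

  With \<open>a = sqrt (2/\<pi>)\<close>, the constant \<open>1 / sqrt (2\<pi>)\<close> is \<open>a/2\<close> and \<open>Q' x = - (a/2) exp (-x\<^sup>2/2)\<close>.
  Both summands of \<open>f'\<close> are of the form polynomial times exponential, so comparing their logarithms
  turns the sign of \<open>f'\<close> into that of
  \<open>w x = ln (1 + x/a) - a x\<close> for the lower bound and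
  \<open>w x = a x - (1 - a\<^sup>2) x\<^sup>2 / 2 - ln (1 + a x)\<close> for the upper one.
  Again \<open>w 0 = 0\<close>, and the derivative of \<open>w\<close> is rational, with at most one change of sign on the
  positive axis, from plus to minus. Hence \<open>w\<close>, and with it \<open>f'\<close>, also changes sign at most once, from
  plus to minus. Both steps rest on the same minimum principle
  \<open>ge_min_endpoints\<close>, applied to \<open>w\<close> on an interval and to \<open>f\<close> on the half-line.
\<close>

section \<open>Functions that rise and then fall\<close>

text \<open>
  That \<open>f\<close> first rises and then falls is expressed by saying that the set of points where
  \<open>f' \<ge> 0\<close> is downward closed, so that no turning point has to be located: \<open>f\<close> increases
  up to \<open>s\<close> if \<open>f' s \<ge> 0\<close>, and decreases from \<open>s\<close> on otherwise.
\<close>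

lemma ge_min_endpoints:
  fixes f f' :: "real \<Rightarrow> real"
  assumes deriv: "\<And>x. a \<le> x \<Longrightarrow> x \<le> b \<Longrightarrow> (f has_real_derivative f' x) (at x)"
    and down: "\<And>s t. a \<le> s \<Longrightarrow> s \<le> t \<Longrightarrow> t \<le> b \<Longrightarrow> f' t \<ge> 0 \<Longrightarrow> f' s \<ge> 0"
    and s: "a \<le> s" "s \<le> b"
  shows "min (f a) (f b) \<le> f s"
proof (cases "f' s \<ge> 0")
  case True
  have "f a \<le> f s"
  proof (rule DERIV_nonneg_imp_nondecreasing[OF s(1)])
    fix x assume "a \<le> x" "x \<le> s"
    then show "\<exists>y. (f has_real_derivative y) (at x) \<and> 0 \<le> y"
      using deriv[of x] down[of x s] True s by auto
  qed
  then show ?thesis by simp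
next
  case False
  have "f b \<le> f s"
  proof (rule DERIV_nonpos_imp_nonincreasing[OF s(2)])
    fix x assume "s \<le> x" "x \<le> b"
    then show "\<exists>y. (f has_real_derivative y) (at x) \<and> y \<le> 0"
      using deriv[of x] down[of s x] False s by force
  qed
  then show ?thesis by simp
qed

text \<open>
  The half-line version follows by letting the right endpoint of the interval tend to infinity.
\<close>

lemma nonneg_if_vanishes_at_ends:
  fixes f f' :: "real \<Rightarrow> real"
  assumes deriv: "\<And>x. 0 \<le> x \<Longrightarrow> (f has_real_derivative f' x) (at x)"
    and down: "\<And>s t. 0 \<le> s \<Longrightarrow> s \<le> t \<Longrightarrow> f' t \<ge> 0 \<Longrightarrow> f' s \<ge> 0"
    and zero: "f 0 = 0" and lim: "(f \<longlongrightarrow> 0) at_top"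
    and x: "0 \<le> x"
  shows "0 \<le> f x"
proof (rule tendsto_upperbound)
  show "((\<lambda>b. min (f 0) (f b)) \<longlongrightarrow> 0) at_top"
    using tendsto_min[OF tendsto_const lim, of "f 0"] by (simp add: zero)
  show "\<forall>\<^sub>F b in at_top. min (f 0) (f b) \<le> f x"
    using eventually_ge_at_top[of x]
    by eventually_elim (rule ge_min_endpoints[of 0 _ f f', OF deriv down x])
qed simp

section \<open>Analytic properties of the Q-function\<close>

lemma gaussian_Q_split:
  assumes "c \<le> x"
  shows "gaussian_Q x = gaussian_Q c - 1 / sqrt (2 * pi) * (LBINT u:{c..x}. exp (- (u\<^sup>2 / 2)))"
proof -
  let ?g = "\<lambda>u::real. exp (- (u\<^sup>2 / 2))"
  have "(LBINT u:{c..x} \<union> {x..}. ?g u) = (LBINT u:{c..x}. ?g u) + (LBINT u:{x..}. ?g u)"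
  proof (rule set_integral_Un_AE)
    show "AE u in lborel. \<not> (u \<in> {c..x} \<and> u \<in> {x..})"
      using AE_lborel_singleton[of x] by eventually_elim auto
    show "set_integrable lborel {c..x} ?g"
      by (rule set_integrable_subset[OF gaussian_Q_integrable[of c]]) auto
  qed (auto intro: gaussian_Q_integrable)
  moreover have "{c..x} \<union> {x..} = {c..}" using assms by auto
  ultimately show ?thesis by (simp add: gaussian_Q_def algebra_simps)
qed

lemma gaussian_Q_has_real_derivative:
  "(gaussian_Q has_real_derivative - (1 / sqrt (2 * pi) * exp (- (x\<^sup>2 / 2)))) (at x)"
proof -
  let ?g = "\<lambda>u::real. exp (- (u\<^sup>2 / 2))"
  \<comment> \<open>any base point left of \<open>x\<close> makes the derivative two-sided\<close>
  let ?c = "x - 1"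
  let ?I = "\<lambda>y. gaussian_Q ?c - 1 / sqrt (2 * pi) * integral {?c..y} ?g"
  have "((\<lambda>y. integral {?c..y} ?g) has_real_derivative ?g x) (at x within {?c..x+1})"
    by (rule integral_has_real_derivative) (auto intro!: continuous_intros)
  then have I: "((\<lambda>y. integral {?c..y} ?g) has_real_derivative ?g x) (at x)"
    by (simp add: at_within_Icc_at)
  have D: "(?I has_real_derivative - (1 / sqrt (2 * pi) * ?g x)) (at x)"
    by (rule DERIV_cong[OF DERIV_diff[OF DERIV_const DERIV_cmult[OF I]]]) simp
  have E: "?I y = gaussian_Q y" if "y \<in> {?c<..}" for y
  proof -
    have "set_integrable lborel {?c..y} ?g"
      by (rule set_integrable_subset[OF gaussian_Q_integrable[of ?c]]) auto
    from set_borel_integral_eq_integral(2)[OF this] show ?thesis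
      using gaussian_Q_split[of ?c y] that by simp
  qed
  show ?thesis
    by (rule has_field_derivative_transform_within_open[OF D _ _ E, of "{?c<..}"]) auto
qed

lemma gaussian_Q_tendsto_0: "(gaussian_Q \<longlongrightarrow> 0) at_top"
proof -
  let ?g = "\<lambda>u::real. exp (- (u\<^sup>2 / 2))"
  have "((\<lambda>x. LBINT u:{0..x}. ?g u) \<longlongrightarrow> (LBINT u:{0..}. ?g u)) at_top"
    by (intro tendsto_set_lebesgue_integral_at_top gaussian_Q_integrable) auto
  then have "((\<lambda>x. gaussian_Q 0 - 1 / sqrt (2 * pi) * (LBINT u:{0..x}. ?g u))
      \<longlongrightarrow> gaussian_Q 0 - 1 / sqrt (2 * pi) * (LBINT u:{0..}. ?g u)) at_top"
    by (intro tendsto_intros)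
  then have "((\<lambda>x. gaussian_Q 0 - 1 / sqrt (2 * pi) * (LBINT u:{0..x}. ?g u)) \<longlongrightarrow> 0) at_top"
    by (simp add: gaussian_Q_def)
  moreover have "\<forall>\<^sub>F x in at_top.
      gaussian_Q 0 - 1 / sqrt (2 * pi) * (LBINT u:{0..x}. ?g u) = gaussian_Q x"
    using eventually_ge_at_top[of 0] by eventually_elim (rule gaussian_Q_split[symmetric])
  ultimately show ?thesis by (rule Lim_transform_eventually)
qed

lemma gaussian_Q_0: "gaussian_Q 0 = 1 / 2"
proof -
  \<comment> \<open>the half-line Gaussian integral of \<open>exp (-x\<^sup>2)\<close>, rescaled by \<open>1 / sqrt 2\<close>\<close>
  have "has_bochner_integral lborel
      (\<lambda>x. indicator {0..} (0 + 1 / sqrt 2 * x) *\<^sub>R exp (- (0 + 1 / sqrt 2 * x)\<^sup>2))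
      ((sqrt pi / 2) /\<^sub>R \<bar>1 / sqrt 2\<bar>)"
    using gaussian_moment_0
      lborel_has_bochner_integral_real_affine_iff[of "1 / sqrt 2" _ "sqrt pi / 2" 0] by simp
  also have "(\<lambda>x. indicator {0..} (0 + 1 / sqrt 2 * x) *\<^sub>R exp (- (0 + 1 / sqrt 2 * x)\<^sup>2))
      = (\<lambda>x::real. indicator {0..} x *\<^sub>R exp (- (x\<^sup>2 / 2)))"
    by (auto simp: indicator_def power_divide zero_le_divide_iff)
  finally have "(LBINT u:{0..}. exp (- (u\<^sup>2 / 2))) = sqrt pi / 2 * sqrt 2"
    by (simp add: set_lebesgue_integral_def has_bochner_integral_iff)
  then show ?thesis by (simp add: gaussian_Q_def real_sqrt_mult)
qed

section \<open>The two bounds\<close>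

text \<open>
  The positive factor \<open>exp (-x\<^sup>2/2)\<close> splits off the derivative of the difference, so
  the sign of the derivative is that of \<open>(1 + x/a) exp (-a x) - 1\<close>, or of its logarithmic form \<open>w\<close>,
  whose derivative \<open>1 / (a + x) - a\<close> decreases.
\<close>

lemma gaussian_Q_lower:
  fixes a x :: real
  assumes a: "a > 0" "1 / sqrt (2 * pi) = a / 2" and x: "0 \<le> x"
  shows "1 / 2 * exp (- (x\<^sup>2 / 2) - a * x) \<le> gaussian_Q x"
proof -
  define f where "f x = gaussian_Q x - 1 / 2 * exp (- (x\<^sup>2 / 2) - a * x)" for x
  define f' where "f' x = a / 2 * exp (- (x\<^sup>2 / 2)) * ((1 + x / a) * exp (- (a * x)) - 1)" for x
  define w where "w x = ln (1 + x / a) - a * x" for x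
  have sign: "f' t \<ge> 0 \<longleftrightarrow> w t \<ge> 0" if "t \<ge> 0" for t
  proof -
    have pos: "1 + t / a > 0" using that a by (simp add: add_pos_nonneg)
    have eq: "f' t = a / 2 * exp (- (t\<^sup>2 / 2)) * exp (- (a * t)) * (1 + t / a - exp (a * t))"
      by (simp add: f'_def algebra_simps flip: exp_add)
    have "f' t \<ge> 0 \<longleftrightarrow> exp (a * t) \<le> 1 + t / a"
      unfolding eq using a(1) by (simp add: zero_le_mult_iff mult_le_0_iff)
    also have "\<dots> \<longleftrightarrow> a * t \<le> ln (1 + t / a)"
      using pos by (simp add: ln_ge_iff)
    finally show ?thesis by (simp add: w_def)
  qed
  have "0 \<le> f x"
  proof (rule nonneg_if_vanishes_at_ends[where f = f and f' = f', OF _ _ _ _ x])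
    fix x :: real assume "0 \<le> x"
    have "((\<lambda>x. 1 / 2 * exp (- (x\<^sup>2 / 2) - a * x)) has_real_derivative
        - ((x + a) / 2 * exp (- (x\<^sup>2 / 2) - a * x))) (at x)"
      by (auto intro!: derivative_eq_intros simp: algebra_simps)
    from DERIV_diff[OF gaussian_Q_has_real_derivative this]
    have "(f has_real_derivative - (a / 2 * exp (- (x\<^sup>2 / 2)))
        - - ((x + a) / 2 * exp (- (x\<^sup>2 / 2) - a * x))) (at x)"
      by (simp only: f_def[abs_def] a(2))
    also have "exp (- (x\<^sup>2 / 2) - a * x) = exp (- (x\<^sup>2 / 2)) * exp (- (a * x))"
      by (simp flip: exp_add)
    finally show "(f has_real_derivative f' x) (at x)"
      by (rule DERIV_cong) (use a(1) in \<open>simp add: f'_def field_simps\<close>)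
  next
    fix s t :: real assume st: "0 \<le> s" "s \<le> t" and "f' t \<ge> 0"
    then have "w t \<ge> 0" using sign by simp
    have "min (w 0) (w t) \<le> w s"
    proof (rule ge_min_endpoints[of 0 t w "\<lambda>x. 1 / (a + x) - a"])
      fix y :: real assume y: "0 \<le> y"
      have "1 + y / a > 0" using y a by (simp add: add_pos_nonneg)
      then show "(w has_real_derivative 1 / (a + y) - a) (at y)"
        unfolding w_def using a y
        by (auto intro!: derivative_eq_intros simp: field_simps)
    next
      fix p q :: real assume "0 \<le> p" "p \<le> q" "0 \<le> 1 / (a + q) - a"
      moreover have "1 / (a + q) \<le> 1 / (a + p)"
        using a \<open>0 \<le> p\<close> \<open>p \<le> q\<close> by (simp add: frac_le)
      ultimately show "0 \<le> 1 / (a + p) - a" by linarith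
    qed (use st in auto)
    moreover have "w 0 = 0" by (simp add: w_def)
    ultimately show "f' s \<ge> 0" using \<open>w t \<ge> 0\<close> st sign by simp
  next
    show "f 0 = 0" by (simp add: f_def gaussian_Q_0)
    have "((\<lambda>x. 1 / 2 * exp (- (x\<^sup>2 / 2) - a * x)) \<longlongrightarrow> 0) at_top"
      using a(1) by real_asymp
    from tendsto_diff[OF gaussian_Q_tendsto_0 this] show "(f \<longlongrightarrow> 0) at_top"
      by (simp add: f_def[abs_def])
  qed
  then show ?thesis by (simp add: f_def)
qed

text \<open>
  For \<open>a = sqrt (2/\<pi>)\<close>, the coefficient \<open>a\<^sup>2/2\<close> is \<open>1/\<pi>\<close>. With it the exponent of the bound has
  derivative \<open>- a (1 + a x)\<close>, so that the derivative of the difference has the sign of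
  \<open>1 - (1 + a x) exp ((1 - a\<^sup>2) x\<^sup>2 / 2 - a x)\<close>. Taking logarithms gives \<open>w\<close>, whose derivative \<open>w'\<close> has
  the sign of its linear factor \<open>2 a\<^sup>2 - 1 - (1 - a\<^sup>2) a x\<close> for \<open>x > 0\<close>; since \<open>a \<le> 1\<close>, that factor
  never increases.
\<close>

lemma gaussian_Q_upper:
  fixes a x :: real
  assumes a: "a > 0" "a \<le> 1" "1 / sqrt (2 * pi) = a / 2" and x: "0 \<le> x"
  shows "gaussian_Q x \<le> 1 / 2 * exp (- (a\<^sup>2 * x\<^sup>2 / 2) - a * x)"
proof -
  define f where "f x = 1 / 2 * exp (- (a\<^sup>2 * x\<^sup>2 / 2) - a * x) - gaussian_Q x" for x
  define f' where
    "f' x = a / 2 * (exp (- (x\<^sup>2 / 2)) - (1 + a * x) * exp (- (a\<^sup>2 * x\<^sup>2 / 2) - a * x))" for x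
  define w where "w x = a * x - (1 - a\<^sup>2) * x\<^sup>2 / 2 - ln (1 + a * x)" for x
  define w' where "w' x = x * (2 * a\<^sup>2 - 1 - (1 - a\<^sup>2) * a * x) / (1 + a * x)" for x
  have pos: "1 + a * t > 0" if "t \<ge> 0" for t
    using that a by (simp add: add_pos_nonneg)
  have sign: "f' t \<ge> 0 \<longleftrightarrow> w t \<ge> 0" if "t \<ge> 0" for t
  proof -
    have "f' t \<ge> 0 \<longleftrightarrow>
        exp (ln (1 + a * t) + (- (a\<^sup>2 * t\<^sup>2 / 2) - a * t)) \<le> exp (- (t\<^sup>2 / 2))"
      using a pos[OF that] by (simp add: f'_def zero_le_mult_iff exp_add)
    also have "\<dots> \<longleftrightarrow> w t \<ge> 0"
      unfolding exp_le_cancel_iff w_def by (simp add: field_simps)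
    finally show ?thesis .
  qed
  have "0 \<le> f x"
  proof (rule nonneg_if_vanishes_at_ends[where f = f and f' = f', OF _ _ _ _ x])
    fix x :: real assume "0 \<le> x"
    have "((\<lambda>x. 1 / 2 * exp (- (a\<^sup>2 * x\<^sup>2 / 2) - a * x)) has_real_derivative
        - (a / 2 * (1 + a * x) * exp (- (a\<^sup>2 * x\<^sup>2 / 2) - a * x))) (at x)"
      by (auto intro!: derivative_eq_intros simp: algebra_simps power2_eq_square)
    from DERIV_diff[OF this gaussian_Q_has_real_derivative]
    show "(f has_real_derivative f' x) (at x)"
      unfolding f_def f'_def a(3) by (rule DERIV_cong) (simp add: algebra_simps)
  next
    fix s t :: real assume st: "0 \<le> s" "s \<le> t" and "f' t \<ge> 0"
    then have "w t \<ge> 0" using sign by simp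
    have "min (w 0) (w t) \<le> w s"
    proof (rule ge_min_endpoints[of 0 t w w'])
      fix y :: real assume y: "0 \<le> y"
      have "(w has_real_derivative a - (1 - a\<^sup>2) * y - a / (1 + a * y)) (at y)"
        unfolding w_def using pos[OF y]
        by (auto intro!: derivative_eq_intros)
      also have "a - (1 - a\<^sup>2) * y - a / (1 + a * y) = w' y"
        using pos[OF y] by (simp add: w'_def field_simps power2_eq_square)
      finally show "(w has_real_derivative w' y) (at y)" .
    next
      fix p q :: real assume pq: "0 \<le> p" "p \<le> q" "0 \<le> w' q"
      show "0 \<le> w' p"
      proof (cases "p = 0")
        case True
        then show ?thesis by (simp add: w'_def)
      next
        case False
        then have "(1 - a\<^sup>2) * a * q \<le> 2 * a\<^sup>2 - 1"
          using pq pos[of q] by (simp add: w'_def zero_le_divide_iff zero_le_mult_iff)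
        moreover have "(1 - a\<^sup>2) * a * p \<le> (1 - a\<^sup>2) * a * q"
          using pq a by (intro mult_left_mono) (auto simp: power_le_one)
        ultimately show ?thesis
          using pq pos[of p] by (simp add: w'_def)
      qed
    qed (use st in auto)
    moreover have "w 0 = 0" by (simp add: w_def)
    ultimately show "f' s \<ge> 0" using \<open>w t \<ge> 0\<close> st sign by simp
  next
    show "f 0 = 0" by (simp add: f_def gaussian_Q_0)
    have "((\<lambda>x. 1 / 2 * exp (- (a\<^sup>2 * x\<^sup>2 / 2) - a * x)) \<longlongrightarrow> 0) at_top"
      using a(1) by real_asymp
    from tendsto_diff[OF this gaussian_Q_tendsto_0] show "(f \<longlongrightarrow> 0) at_top"
      by (simp add: f_def[abs_def])
  qed
  then show ?thesis by (simp add: f_def)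
qed

theorem theorem1:
  fixes x :: real
  assumes "x \<ge> 0"
  shows "gaussian_Q x \<ge> 1 / 2 * exp (- (1 / 2) * x\<^sup>2 - sqrt (2 / pi) * x)
    \<and> gaussian_Q x \<le> 1 / 2 * exp (- (1 / pi) * x\<^sup>2 - sqrt (2 / pi) * x)"
proof -
  let ?a = "sqrt (2 / pi)"
  have "?a > 0" by simp
  moreover have "?a \<le> 1" using pi_ge_two by simp
  moreover have "1 / sqrt (2 * pi) = ?a / 2"
    by (simp add: real_sqrt_mult real_sqrt_divide field_simps)
  moreover have "?a\<^sup>2 = 2 / pi" by simp
  ultimately show ?thesis
    using gaussian_Q_lower[of ?a x] gaussian_Q_upper[of ?a x] assms by simp
qed

end
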